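(* Let $n\ge 2$ be an integer, let $X=\mathbb{Z}/n\mathbb{Z}$, and let $A_{1+t}=(X,X,\rho,\tau)$ be the invertible automaton with set of states $X$, alphabet $X$, and $$\rho(y,x)=y+x,\qquad \tau(y,x)=x \qquad (y,x\in X).$$ Then the group $G(A_{1+t})$ of this automaton is isomorphic to the lamplighter group $$L_n=\Big(\bigoplus_{\mathbb{Z}}\mathbb{Z}/n\mathbb{Z}\Big)\rtimes\mathbb{Z}=(\mathbb{Z}/n\mathbb{Z})\wr\mathbb{Z},$$ where $\mathbb{Z}$ acts by translating the index set $\mathbb{Z}$ of the direct sum.
   Context: An automaton is a quadruple $A=(Q,X,\rho,\tau)$ with $Q$ a finite set (states), $X$ a finite set (alphabet), and functions $\rho:Q\times X\to X$ (rewriting) and $\tau:Q\times X\to Q$ (transition). It is invertible if for every $q\in Q$ the map $\rho_q:X\to X$, $x\mapsto\rho(q,x)$, is a permutation. Each state $q$ of an invertible automaton defines an automorphism, also denoted $q$, of the rooted tree $X^*$ of finite words over $X$ (equivalently a transformation of the infinite words over $X$), recursively by $q(\emptyset)=\emptyset$ and $q(xw)=\rho(q,x)\,q_x(w)$, where $q_x=\tau(q,x)$, for $x\in X$ and $w$ a word. The group of the automaton, $G(A)$, is the subgroup of $\mathrm{Aut}(X^* )$ generated by the automorphisms defined by all states $q\in Q$. *)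

theory Defs
  imports "HOL-Algebra.Bij" "HOL-Algebra.Product_Groups"
begin

section \<open>Automata\<close>

record ('q, 'x) automaton =
  states :: "'q set"
  alphabet :: "'x set"
  rewriting :: "'q \<Rightarrow> 'x \<Rightarrow> 'x"
  transition :: "'q \<Rightarrow> 'x \<Rightarrow> 'q"

text \<open>
  \<^const>\<open>rewriting\<close> and \<^const>\<open>transition\<close> are total functions on the underlying types; only
  their values on \<^term>\<open>states A \<times> alphabet A\<close> matter.
\<close>

definition automaton :: "('q, 'x) automaton \<Rightarrow> bool" where
  "automaton A \<longleftrightarrow>
     finite (states A) \<and> finite (alphabet A) \<and>
     rewriting A \<in> states A \<rightarrow> alphabet A \<rightarrow> alphabet A \<and>
     transition A \<in> states A \<rightarrow> alphabet A \<rightarrow> states A"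

definition invertible_automaton :: "('q, 'x) automaton \<Rightarrow> bool" where
  "invertible_automaton A \<longleftrightarrow>
     automaton A \<and> (\<forall>q \<in> states A. bij_betw (rewriting A q) (alphabet A) (alphabet A))"

primrec run :: "('q, 'x) automaton \<Rightarrow> 'q \<Rightarrow> 'x list \<Rightarrow> 'x list" where
  "run A q [] = []"
| "run A q (x # w) = rewriting A q x # run A (transition A q x) w"

text \<open>
  The restriction to words over the alphabet makes equality of state maps equality of
  transformations of the tree, as required by the extensional functions in \<^const>\<open>Bij\<close>.
\<close>

definition state_map :: "('q, 'x) automaton \<Rightarrow> 'q \<Rightarrow> 'x list \<Rightarrow> 'x list" where
  "state_map A q = restrict (run A q) (lists (alphabet A))"

section \<open>The automorphism group of the rooted tree of words\<close>

definition tree_adj :: "'x list \<Rightarrow> 'x list \<Rightarrow> bool" where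
  "tree_adj u v \<longleftrightarrow> (\<exists>x. v = u @ [x] \<or> u = v @ [x])"

definition tree_automorphisms :: "'x set \<Rightarrow> ('x list \<Rightarrow> 'x list) set" where
  "tree_automorphisms X =
     {f \<in> Bij (lists X). f [] = [] \<and>
        (\<forall>u \<in> lists X. \<forall>v \<in> lists X. tree_adj (f u) (f v) \<longleftrightarrow> tree_adj u v)}"

definition tree_aut_group :: "'x set \<Rightarrow> ('x list \<Rightarrow> 'x list) monoid" where
  "tree_aut_group X = BijGroup (lists X) \<lparr>carrier := tree_automorphisms X\<rparr>"

lemma subgroup_tree_automorphisms: "subgroup (tree_automorphisms X) (BijGroup (lists X))"
proof (rule group.subgroupI [OF group_BijGroup])
  show "tree_automorphisms X \<subseteq> carrier (BijGroup (lists X))"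
    by (auto simp: tree_automorphisms_def BijGroup_def)
  have "(\<lambda>x\<in>lists X. x) \<in> tree_automorphisms X"
    using id_Bij by (auto simp: tree_automorphisms_def)
  then show "tree_automorphisms X \<noteq> {}" by blast
next
  fix f assume f: "f \<in> tree_automorphisms X"
  then have B: "f \<in> Bij (lists X)" by (simp add: tree_automorphisms_def)
  then have bij: "bij_betw f (lists X) (lists X)" by (simp add: Bij_def)
  let ?g = "inv_into (lists X) f"
  have g: "?g u \<in> lists X" "f (?g u) = u" if "u \<in> lists X" for u
    using that bij Bij_inv_into_mem [OF B] by (auto simp: bij_betw_inv_into_right)
  have "?g [] = []"
    using f bij_betw_inv_into_left [OF bij, of "[]"] by (simp add: tree_automorphisms_def)
  moreover have "tree_adj (?g u) (?g v) \<longleftrightarrow> tree_adj u v" if "u \<in> lists X" "v \<in> lists X" for u v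
  proof -
    have "tree_adj (f (?g u)) (f (?g v)) \<longleftrightarrow> tree_adj (?g u) (?g v)"
      using f g(1) that unfolding tree_automorphisms_def by blast
    then show ?thesis using g(2) that by simp
  qed
  ultimately show "inv\<^bsub>BijGroup (lists X)\<^esub> f \<in> tree_automorphisms X"
    using inv_BijGroup [OF B] restrict_inv_into_Bij [OF B]
    by (auto simp: tree_automorphisms_def)
next
  fix f g assume f: "f \<in> tree_automorphisms X" and g: "g \<in> tree_automorphisms X"
  then have B: "f \<in> Bij (lists X)" "g \<in> Bij (lists X)" by (simp_all add: tree_automorphisms_def)
  have gl: "g u \<in> lists X" if "u \<in> lists X" for u
    using Bij_imp_funcset [OF B(2)] that by (rule funcset_mem)
  have "tree_adj (f (g u)) (f (g v)) \<longleftrightarrow> tree_adj u v" if "u \<in> lists X" "v \<in> lists X" for u v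
  proof -
    have "tree_adj (f (g u)) (f (g v)) \<longleftrightarrow> tree_adj (g u) (g v)"
      using f gl that unfolding tree_automorphisms_def by blast
    also have "\<dots> \<longleftrightarrow> tree_adj u v"
      using g that unfolding tree_automorphisms_def by blast
    finally show ?thesis .
  qed
  moreover have "f (g []) = []"
    using f g by (simp add: tree_automorphisms_def)
  ultimately have "compose (lists X) f g \<in> tree_automorphisms X"
    using compose_Bij [OF B] by (simp add: tree_automorphisms_def compose_def)
  then show "f \<otimes>\<^bsub>BijGroup (lists X)\<^esub> g \<in> tree_automorphisms X"
    using B by (simp add: BijGroup_def)
qed

lemma group_tree_aut_group: "group (tree_aut_group X)"
  unfolding tree_aut_group_def
  by (rule subgroup.subgroup_is_group [OF subgroup_tree_automorphisms group_BijGroup])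

lemma length_run [simp]: "length (run A q w) = length w"
  by (induction w arbitrary: q) auto

lemma run_append_letter: "\<exists>y. run A q (w @ [x]) = run A q w @ [y]"
  by (induction w arbitrary: q) auto

lemma run_in_lists:
  assumes "automaton A" "q \<in> states A" "w \<in> lists (alphabet A)"
  shows "run A q w \<in> lists (alphabet A)"
  using assms(3,2)
proof (induction w arbitrary: q rule: list.induct)
  case (Cons x w)
  then have "rewriting A q x \<in> alphabet A" "transition A q x \<in> states A"
    using assms(1) by (auto simp: automaton_def Pi_iff)
  then show ?case using Cons by auto
qed auto

lemma bij_betw_run:
  assumes A: "invertible_automaton A" and q: "q \<in> states A"
  shows "bij_betw (run A q) (lists (alphabet A)) (lists (alphabet A))"
proof -
  let ?L = "lists (alphabet A)"
  have aut: "automaton A" using A by (simp add: invertible_automaton_def)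
  have bij: "bij_betw (rewriting A p) (alphabet A) (alphabet A)" if "p \<in> states A" for p
    using A that by (simp add: invertible_automaton_def)
  have tr: "transition A p x \<in> states A" if "p \<in> states A" "x \<in> alphabet A" for p x
    using aut that by (auto simp: automaton_def Pi_iff)
  have inj: "u = v" if "u \<in> ?L" "v \<in> ?L" "p \<in> states A" "run A p u = run A p v" for u v p
    using that
  proof (induction u arbitrary: v p rule: list.induct)
    case Nil
    then have "length v = 0" by (metis length_run list.size(3))
    then show ?case by simp
  next
    case (Cons x u)
    then obtain y v' where v: "v = y # v'" by (cases v) auto
    have xy: "x \<in> alphabet A" "y \<in> alphabet A" "rewriting A p x = rewriting A p y"
      using Cons.prems by (simp_all add: v)
    then have "x = y"
      using bij [OF Cons.prems(3)] by (auto simp: bij_betw_def dest: inj_onD)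
    then show ?case
      using Cons.IH [of v' "transition A p x"] Cons.prems tr xy(1) by (auto simp: v)
  qed
  have surj: "\<exists>u \<in> ?L. run A p u = w" if "w \<in> ?L" "p \<in> states A" for w p
    using that
  proof (induction w arbitrary: p rule: list.induct)
    case Nil
    then show ?case by (intro bexI [of _ "[]"]) auto
  next
    case (Cons y w)
    then have y: "y \<in> rewriting A p ` alphabet A"
      using bij [OF Cons.prems(2)] by (simp add: bij_betw_def)
    then obtain x where x: "x \<in> alphabet A" "rewriting A p x = y" by blast
    have "w \<in> ?L" using Cons.prems(1) by simp
    then obtain u where "u \<in> ?L" "run A (transition A p x) u = w"
      using Cons.IH tr [OF Cons.prems(2) x(1)] by blast
    then show ?case using x by (intro bexI [of _ "x # u"]) auto
  qed
  show ?thesis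
    unfolding bij_betw_def inj_on_def
  proof (intro conjI ballI impI equalityI subsetI)
    fix u v assume "u \<in> ?L" "v \<in> ?L" "run A q u = run A q v"
    then show "u = v" using inj q by blast
  next
    fix w assume "w \<in> run A q ` ?L"
    then show "w \<in> ?L" using run_in_lists [OF aut q] by blast
  next
    fix w assume "w \<in> ?L"
    then show "w \<in> run A q ` ?L" using surj [OF _ q] by blast
  qed
qed

theorem state_map_in_tree_aut_group:
  assumes A: "invertible_automaton A" and q: "q \<in> states A"
  shows "state_map A q \<in> carrier (tree_aut_group (alphabet A))"
proof -
  let ?L = "lists (alphabet A)"
  have bij: "bij_betw (run A q) ?L ?L" by (rule bij_betw_run [OF A q])
  then have "state_map A q \<in> Bij ?L"
    by (simp add: Bij_def state_map_def bij_betw_restrict_eq)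
  moreover have ext: "\<exists>x. v = u @ [x]"
    if "u \<in> ?L" "v \<in> ?L" and y: "run A q v = run A q u @ [y]" for u v y
  proof -
    have "length v = Suc (length u)"
      using arg_cong [OF y, of length] by simp
    then obtain v' x where v: "v = v' @ [x]" by (cases v rule: rev_cases) auto
    then have "run A q v' = run A q u"
      using run_append_letter [of A q v' x] y by auto
    moreover have "v' \<in> ?L" using that(2) v by auto
    ultimately have "v' = u" using bij that(1) by (auto simp: bij_betw_def dest: inj_onD)
    then show ?thesis using v by blast
  qed
  moreover have "tree_adj (run A q u) (run A q v) \<longleftrightarrow> tree_adj u v" if "u \<in> ?L" "v \<in> ?L" for u v
    using ext [OF that] ext [OF that(2,1)] run_append_letter [of A q]
    unfolding tree_adj_def by metis
  ultimately show ?thesis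
    by (simp add: tree_aut_group_def tree_automorphisms_def state_map_def)
qed

section \<open>The group of an automaton\<close>

text \<open>
  \<^const>\<open>subgroup_generated\<close> discards generators outside the ambient group; by
  \<open>state_map_in_tree_aut_group\<close> there are none when the automaton is invertible.
\<close>

definition automaton_group :: "('q, 'x) automaton \<Rightarrow> ('x list \<Rightarrow> 'x list) monoid" where
  "automaton_group A =
     subgroup_generated (tree_aut_group (alphabet A)) (state_map A ` states A)"

lemma group_automaton_group: "group (automaton_group A)"
  unfolding automaton_group_def
  by (rule group.group_subgroup_generated [OF group_tree_aut_group])

text \<open>The ring $\mathbb{Z}/n\mathbb{Z}$ is represented by the residues $0, \dots, n - 1$.\<close>

definition automaton_1_plus_t :: "nat \<Rightarrow> (int, int) automaton" where
  "automaton_1_plus_t n =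
     \<lparr>states = carrier (integer_mod_group n),
      alphabet = carrier (integer_mod_group n),
      rewriting = (\<lambda>y x. y \<otimes>\<^bsub>integer_mod_group n\<^esub> x),
      transition = (\<lambda>y x. x)\<rparr>"

lemma invertible_automaton_1_plus_t:
  assumes "n > 0"
  shows "invertible_automaton (automaton_1_plus_t n)"
proof -
  interpret Z: group "integer_mod_group n" by simp
  have fin: "finite (carrier (integer_mod_group n))"
    using assms by (simp add: carrier_integer_mod_group)
  have cl: "mult (integer_mod_group n) \<in>
      carrier (integer_mod_group n) \<rightarrow> carrier (integer_mod_group n) \<rightarrow> carrier (integer_mod_group n)"
    by (rule Z.mult_funcset)
  have "bij_betw (mult (integer_mod_group n) y)
      (carrier (integer_mod_group n)) (carrier (integer_mod_group n))"
    if "y \<in> carrier (integer_mod_group n)" for y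
    using Z.inj_on_multc Z.surj_const_mult [OF that] Z.inj_on_cmult [OF that]
    by (auto simp: bij_betw_def)
  then show ?thesis
    using fin cl
    by (simp add: invertible_automaton_def automaton_def automaton_1_plus_t_def
        del: mult_integer_mod_group)
qed

section \<open>Semidirect products and lamplighter groups\<close>

definition semidirect_product ::
    "('a, 'c) monoid_scheme \<Rightarrow> ('b, 'd) monoid_scheme \<Rightarrow> ('b \<Rightarrow> 'a \<Rightarrow> 'a) \<Rightarrow> ('a \<times> 'b) monoid" where
  "semidirect_product N H \<phi> =
     \<lparr>carrier = carrier N \<times> carrier H,
      mult = (\<lambda>(a, g) (b, h). (a \<otimes>\<^bsub>N\<^esub> \<phi> g b, g \<otimes>\<^bsub>H\<^esub> h)),
      one = (\<one>\<^bsub>N\<^esub>, \<one>\<^bsub>H\<^esub>)\<rparr>"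

lemma group_semidirect_product:
  assumes N: "group N" and H: "group H" and \<phi>: "\<phi> \<in> hom H (AutoGroup N)"
  shows "group (semidirect_product N H \<phi>)"
proof -
  interpret N: group N by fact
  interpret H: group H by fact
  have auto: "\<phi> g \<in> hom N N" "\<phi> g \<in> Bij (carrier N)" if "g \<in> carrier H" for g
    using hom_in_carrier [OF \<phi> that] by (auto simp: AutoGroup_def auto_def)
  have cl: "\<phi> g a \<in> carrier N" if "g \<in> carrier H" "a \<in> carrier N" for g a
    using auto(1) that hom_in_carrier by fastforce
  have mult: "\<phi> g (a \<otimes>\<^bsub>N\<^esub> b) = \<phi> g a \<otimes>\<^bsub>N\<^esub> \<phi> g b"
    if "g \<in> carrier H" "a \<in> carrier N" "b \<in> carrier N" for g a b
    using auto(1) that hom_mult by fastforce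
  have comp: "\<phi> (g \<otimes>\<^bsub>H\<^esub> h) a = \<phi> g (\<phi> h a)"
    if "g \<in> carrier H" "h \<in> carrier H" "a \<in> carrier N" for g h a
    using hom_mult [OF \<phi> that(1,2)] auto(2) that
    by (simp add: AutoGroup_def BijGroup_def compose_def)
  have one: "\<phi> \<one>\<^bsub>H\<^esub> a = a" if "a \<in> carrier N" for a
  proof -
    have "inj_on (\<phi> \<one>\<^bsub>H\<^esub>) (carrier N)"
      using auto(2) [of "\<one>\<^bsub>H\<^esub>"] by (simp add: Bij_def bij_betw_def)
    then show ?thesis
      using comp [of "\<one>\<^bsub>H\<^esub>" "\<one>\<^bsub>H\<^esub>" a] that cl by (auto dest: inj_onD)
  qed
  show ?thesis
  proof (rule groupI)
    fix x assume "x \<in> carrier (semidirect_product N H \<phi>)"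
    then obtain a g where x: "x = (a, g)" "a \<in> carrier N" "g \<in> carrier H"
      by (auto simp: semidirect_product_def)
    let ?y = "(\<phi> (inv\<^bsub>H\<^esub> g) (inv\<^bsub>N\<^esub> a), inv\<^bsub>H\<^esub> g)"
    have "?y \<otimes>\<^bsub>semidirect_product N H \<phi>\<^esub> x = \<one>\<^bsub>semidirect_product N H \<phi>\<^esub>"
      using x mult [of "inv\<^bsub>H\<^esub> g" "inv\<^bsub>N\<^esub> a" a, symmetric] auto(1) [of "inv\<^bsub>H\<^esub> g"]
        hom_one [OF _ N N]
      by (simp add: semidirect_product_def)
    moreover have "?y \<in> carrier (semidirect_product N H \<phi>)"
      using x cl by (simp add: semidirect_product_def)
    ultimately show "\<exists>y \<in> carrier (semidirect_product N H \<phi>).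
        y \<otimes>\<^bsub>semidirect_product N H \<phi>\<^esub> x = \<one>\<^bsub>semidirect_product N H \<phi>\<^esub>"
      by blast
  qed (auto simp: semidirect_product_def cl mult comp one N.m_assoc H.m_assoc)
qed

definition lamp_group :: "nat \<Rightarrow> (int \<Rightarrow> int) monoid" where
  "lamp_group n = sum_group UNIV (\<lambda>_. integer_mod_group n)"

definition lamp_shift :: "nat \<Rightarrow> int \<Rightarrow> (int \<Rightarrow> int) \<Rightarrow> (int \<Rightarrow> int)" where
  "lamp_shift n k = (\<lambda>f \<in> carrier (lamp_group n). \<lambda>i. f (i - k))"

definition lamplighter_group :: "nat \<Rightarrow> ((int \<Rightarrow> int) \<times> int) monoid" where
  "lamplighter_group n = semidirect_product (lamp_group n) integer_group (lamp_shift n)"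

lemma group_lamp_group: "group (lamp_group n)"
  by (simp add: lamp_group_def)

lemma lamp_shift_closed:
  assumes "f \<in> carrier (lamp_group n)"
  shows "(\<lambda>i. f (i - k)) \<in> carrier (lamp_group n)"
proof -
  have "{i. f (i - k) \<noteq> 0} = (\<lambda>i. i + k) ` {i. f i \<noteq> 0}"
    by (auto simp: image_iff) (metis diff_add_cancel)
  then show ?thesis
    using assms by (auto simp: lamp_group_def carrier_sum_group PiE_iff)
qed

lemma lamp_shift_hom: "lamp_shift n \<in> hom integer_group (AutoGroup (lamp_group n))"
proof -
  have cl: "lamp_shift n k f \<in> carrier (lamp_group n)" if "f \<in> carrier (lamp_group n)" for k f
    using that lamp_shift_closed by (simp add: lamp_shift_def)
  have comp: "lamp_shift n k (lamp_shift n l f) = lamp_shift n (k + l) f"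
    if "f \<in> carrier (lamp_group n)" for k l f
    using that lamp_shift_closed [OF that] by (simp add: lamp_shift_def algebra_simps)
  have zero: "lamp_shift n 0 f = f" if "f \<in> carrier (lamp_group n)" for f
    using that by (simp add: lamp_shift_def)
  have "bij_betw (lamp_shift n k) (carrier (lamp_group n)) (carrier (lamp_group n))" for k
    by (rule bij_betw_byWitness [where f' = "lamp_shift n (- k)"])
       (auto simp: cl comp zero)
  then have Bij: "lamp_shift n k \<in> Bij (carrier (lamp_group n))" for k
    by (simp add: Bij_def lamp_shift_def)
  have "lamp_shift n k \<in> hom (lamp_group n) (lamp_group n)" for k
  proof (rule homI)
    fix f g assume fg: "f \<in> carrier (lamp_group n)" "g \<in> carrier (lamp_group n)"
    then have "f \<otimes>\<^bsub>lamp_group n\<^esub> g \<in> carrier (lamp_group n)"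
      using group_lamp_group [of n] by (simp add: group.is_monoid monoid.m_closed)
    then show "lamp_shift n k (f \<otimes>\<^bsub>lamp_group n\<^esub> g) =
        lamp_shift n k f \<otimes>\<^bsub>lamp_group n\<^esub> lamp_shift n k g"
      using fg by (simp add: lamp_shift_def) (simp add: lamp_group_def restrict_def)
  qed (rule cl)
  moreover have "lamp_shift n (k + l) =
      compose (carrier (lamp_group n)) (lamp_shift n k) (lamp_shift n l)" for k l
    by (rule extensionalityI [of _ "carrier (lamp_group n)"])
       (auto simp: comp compose_def lamp_shift_def [of n "k + l"])
  ultimately show ?thesis
    using Bij by (intro homI) (auto simp: AutoGroup_def auto_def BijGroup_def)
qed

lemma group_lamplighter_group: "group (lamplighter_group n)"
  unfolding lamplighter_group_def
  by (rule group_semidirect_product [OF group_lamp_group group_integer_group lamp_shift_hom])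

end

(*
  Identify a word x_0 x_1 ... x_(L-1) with the truncated power series x_0 + x_1 t + ... modulo n
  and t^L. State y then acts by F |-> (1 + t) F + y, so state 0 is multiplication by 1 + t, and the
  conjugates by its powers of the translations F |-> F + y are the translations by (1 + t)^j y,
  j an integer. Hence the group consists of the maps F |-> (1 + t)^k F + sum_j f_j (1 + t)^j, and
  these compose as in the lamplighter group. The representation is faithful because the powers
  (1 + t)^j, j an integer, are linearly independent over Z/n.
*)

theory Submission
  imports Defs "HOL-Algebra.Generated_Groups" "HOL-Computational_Algebra.Formal_Power_Series"
    "HOL-Number_Theory.Cong"
begin

unbundle fps_syntax

section \<open>Integer powers of 1 + t as power series over the integers\<close>

definition binomial_fps :: "int \<Rightarrow> int fps" where
  "binomial_fps k =
     (if 0 \<le> k then (1 + fps_X) ^ nat k else Abs_fps (\<lambda>i. (- 1) ^ i) ^ nat (- k))"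

text \<open>The alternating geometric series inverts 1 + t over the integers, so negative powers
  also have integer coefficients and can be reduced modulo n.\<close>

lemma one_plus_fps_X_mult_alternating: "(1 + fps_X) * Abs_fps (\<lambda>i. (- 1) ^ i) = (1 :: int fps)"
proof (rule fps_ext)
  fix i show "((1 + fps_X) * Abs_fps (\<lambda>i. (- 1) ^ i)) $ i = (1 :: int fps) $ i"
    by (cases i) (simp_all add: distrib_right)
qed

lemma binomial_fps_0 [simp]: "binomial_fps 0 = 1"
  by (simp add: binomial_fps_def)

lemma binomial_fps_1: "binomial_fps 1 = 1 + fps_X"
  by (simp add: binomial_fps_def)

lemma binomial_fps_int: "binomial_fps (int m) = (1 + fps_X) ^ m"
  by (simp add: binomial_fps_def)

lemma binomial_fps_minus_int: "binomial_fps (- int m) = Abs_fps (\<lambda>i. (- 1) ^ i) ^ m"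
  by (cases m) (simp_all add: binomial_fps_def del: of_nat_Suc)

lemma binomial_fps_plus_1: "binomial_fps (k + 1) = (1 + fps_X) * binomial_fps k"
proof (cases k rule: int_cases)
  case (nonneg m)
  then have "k + 1 = int (Suc m)" by simp
  then show ?thesis by (simp only: nonneg binomial_fps_int power_Suc)
next
  case (neg m)
  then have "k + 1 = - int m" by simp
  then show ?thesis
    by (simp only: neg binomial_fps_minus_int power_Suc mult.assoc [symmetric]
        one_plus_fps_X_mult_alternating mult_1_left)
qed

lemma binomial_fps_minus_1: "binomial_fps (k - 1) = Abs_fps (\<lambda>i. (- 1) ^ i) * binomial_fps k"
proof -
  have "Abs_fps (\<lambda>i. (- 1) ^ i) * binomial_fps k =
      ((1 + fps_X) * Abs_fps (\<lambda>i. (- 1) ^ i)) * binomial_fps (k - 1)"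
    using binomial_fps_plus_1 [of "k - 1"] by (simp add: ac_simps)
  then show ?thesis by (simp add: one_plus_fps_X_mult_alternating)
qed

text \<open>Induction on \<open>k\<close> upwards and downwards from 0: each step multiplies both
  sides by 1 + t or by its inverse.\<close>

lemma binomial_fps_add: "binomial_fps (k + l) = binomial_fps k * binomial_fps l"
proof (induction k rule: int_induct [where k = 0])
  case (step1 k)
  have "binomial_fps (k + 1 + l) = binomial_fps (k + l + 1)" by (simp add: algebra_simps)
  then show ?case using step1 by (simp only: binomial_fps_plus_1 mult.assoc)
next
  case (step2 k)
  have "binomial_fps (k - 1 + l) = binomial_fps (k + l - 1)" by (simp add: algebra_simps)
  then show ?case using step2 by (simp only: binomial_fps_minus_1 mult.assoc)
qed simp

lemma one_plus_fps_X_power_nth: "((1 + fps_X) ^ m :: int fps) $ i = int (m choose i)"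
proof (induction m arbitrary: i)
  case (Suc m)
  then show ?case by (cases i) (simp_all add: distrib_right)
qed simp

section \<open>Lamp configurations as linear combinations of powers of 1 + t\<close>

definition lamp_series :: "(int \<Rightarrow> int) \<Rightarrow> int fps" where
  "lamp_series f = (\<Sum>j | f j \<noteq> 0. fps_const (f j) * binomial_fps j)"

text \<open>Allowing any finite superset of the support lets configurations with different supports
  be compared over one index set.\<close>

lemma lamp_series_eq_sum:
  assumes "finite S" "{j. f j \<noteq> 0} \<subseteq> S"
  shows "lamp_series f = (\<Sum>j\<in>S. fps_const (f j) * binomial_fps j)"
  unfolding lamp_series_def using assms by (intro sum.mono_neutral_left) auto

lemma lamp_series_zero [simp]: "lamp_series (\<lambda>_. 0) = 0"
  by (simp add: lamp_series_def)

lemma lamp_series_single: "lamp_series (\<lambda>i. if i = j then a else 0) = fps_const a * binomial_fps j"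
  by (subst lamp_series_eq_sum [of "{j}"]) auto

lemma lamp_series_diff:
  assumes "finite {j. f j \<noteq> 0}" "finite {j. g j \<noteq> 0}"
  shows "lamp_series (\<lambda>j. f j - g j) = lamp_series f - lamp_series g"
proof -
  let ?S = "{j. f j \<noteq> 0} \<union> {j. g j \<noteq> 0}"
  have "finite ?S" using assms by simp
  then show ?thesis
    by (subst (1 2 3) lamp_series_eq_sum [of ?S])
       (auto simp: sum_subtractf [symmetric] left_diff_distrib simp flip: fps_const_sub)
qed

text \<open>A lamp moved from j to j + k changes its factor from (1 + t)^j to (1 + t)^(j + k). This
  is how the translation action of the lamplighter group appears on the side of power
  series.\<close>

lemma lamp_series_shift: "lamp_series (\<lambda>i. f (i - k)) = binomial_fps k * lamp_series f"
proof -
  have "lamp_series (\<lambda>i. f (i - k)) =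
      (\<Sum>j | f j \<noteq> 0. fps_const (f j) * binomial_fps (k + j))"
    unfolding lamp_series_def
    by (rule sum.reindex_bij_witness [of _ "\<lambda>j. k + j" "\<lambda>i. i - k"]) auto
  then show ?thesis
    by (simp add: lamp_series_def sum_distrib_left binomial_fps_add ac_simps)
qed

text \<open>
  After multiplication by a power of $1 + t$ all exponents are nonnegative, and the largest
  exponent whose coefficient is nonzero modulo $m$ gives the leading coefficient.
\<close>

lemma lamp_series_independent:
  fixes m :: int
  assumes fin: "finite {j. f j \<noteq> 0}" and zero: "\<And>i. m dvd lamp_series f $ i"
  shows "m dvd f j"
proof (rule ccontr)
  assume "\<not> m dvd f j"
  let ?N = "{j. \<not> m dvd f j}"
  define d where "d = Max ?N"
  have "finite ?N" by (rule finite_subset [OF _ fin]) auto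
  then have d: "\<not> m dvd f d" and dmax: "\<And>j. d < j \<Longrightarrow> m dvd f j"
    using Max_in [of ?N] Max_ge [of ?N] \<open>\<not> m dvd f j\<close> unfolding d_def by fastforce+
  \<comment> \<open>\<open>k\<close> is minus the least exponent in the support, the smallest shift
    that makes every exponent nonnegative.\<close>
  define k where "k = Max (uminus ` {j. f j \<noteq> 0})"
  have k: "0 \<le> j + k" if "f j \<noteq> 0" for j
  proof -
    have "- j \<le> k" unfolding k_def using fin that by (intro Max_ge) auto
    then show ?thesis by simp
  qed
  have dS: "d \<in> {j. f j \<noteq> 0}" using d by auto
  let ?e = "nat (d + k)"
  \<comment> \<open>Coefficient \<open>?e\<close> of (1 + t)^(j + k) is a binomial coefficient: 0
    for j < d and 1 for j = d. For j > d the factor \<open>f j\<close> vanishes modulo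
    \<open>m\<close> by maximality of \<open>d\<close>.\<close>
  have coeff: "[f j * binomial_fps (j + k) $ ?e = (if j = d then f d else 0)] (mod m)"
    if "f j \<noteq> 0" for j
  proof -
    have "binomial_fps (j + k) $ ?e = int (nat (j + k) choose ?e)"
      using k [OF that] by (simp add: binomial_fps_def one_plus_fps_X_power_nth)
    moreover have "nat (j + k) < ?e" if "j < d" using k [OF \<open>f j \<noteq> 0\<close>] that by simp
    ultimately show ?thesis using dmax [of j] by (cases j d rule: linorder_cases) (auto simp: cong_0_iff binomial_eq_0)
  qed
  have "binomial_fps k * lamp_series f = (\<Sum>j | f j \<noteq> 0. fps_const (f j) * binomial_fps (j + k))"
    by (simp add: lamp_series_def sum_distrib_left binomial_fps_add ac_simps)
  then have "(binomial_fps k * lamp_series f) $ ?e = (\<Sum>j | f j \<noteq> 0. f j * binomial_fps (j + k) $ ?e)"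
    by (simp add: fps_sum_nth)
  also have "[\<dots> = (\<Sum>j | f j \<noteq> 0. if j = d then f d else 0)] (mod m)"
    by (intro cong_sum) (use coeff in auto)
  also have "(\<Sum>j | f j \<noteq> 0. if j = d then f d else 0) = f d"
    using fin dS by simp
  finally have "[(binomial_fps k * lamp_series f) $ ?e = f d] (mod m)" .
  moreover have "m dvd (binomial_fps k * lamp_series f) $ ?e"
    unfolding fps_mult_nth by (intro dvd_sum dvd_mult zero)
  ultimately show False using d by (simp add: cong_dvd_iff)
qed

section \<open>Words as power series modulo n and a power of t\<close>

definition cong_below :: "nat \<Rightarrow> int \<Rightarrow> int fps \<Rightarrow> int fps \<Rightarrow> bool" where
  "cong_below L m F G \<longleftrightarrow> (\<forall>i<L. [F $ i = G $ i] (mod m))"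

lemma cong_below_refl [simp]: "cong_below L m F F"
  by (simp add: cong_below_def)

lemma cong_below_add:
  "cong_below L m F F' \<Longrightarrow> cong_below L m G G' \<Longrightarrow> cong_below L m (F + G) (F' + G')"
  by (simp add: cong_below_def cong_add)

text \<open>Coefficient i of a product involves only coefficients up to i of the factors, so
  truncation respects multiplication.\<close>

lemma cong_below_mult:
  "cong_below L m F F' \<Longrightarrow> cong_below L m G G' \<Longrightarrow> cong_below L m (F * G) (F' * G')"
  by (auto simp: cong_below_def fps_mult_nth intro!: cong_sum cong_mult)

definition word_fps :: "int list \<Rightarrow> int fps" where
  "word_fps w = Abs_fps (\<lambda>i. if i < length w then w ! i else 0)"

definition fps_word :: "nat \<Rightarrow> nat \<Rightarrow> int fps \<Rightarrow> int list" where
  "fps_word n L F = map (\<lambda>i. F $ i mod int n) [0..<L]"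

lemma length_fps_word [simp]: "length (fps_word n L F) = L"
  by (simp add: fps_word_def)

text \<open>Letters are least nonnegative residues, so each truncated class has exactly one word.
  Equalities of words can thus be proved as congruences of series.\<close>

lemma fps_word_eq_iff: "fps_word n L F = fps_word n L G \<longleftrightarrow> cong_below L (int n) F G"
  by (auto simp: fps_word_def cong_below_def cong_def)

lemma word_fps_fps_word: "cong_below L (int n) (word_fps (fps_word n L F)) F"
  by (simp add: cong_below_def word_fps_def fps_word_def)

lemma fps_word_word_fps:
  assumes "w \<in> lists {0..<int n}"
  shows "fps_word n (length w) (word_fps w) = w"
proof (rule nth_equalityI)
  fix i assume "i < length (fps_word n (length w) (word_fps w))"
  then have i: "i < length w" by simp
  then have "w ! i \<in> {0..<int n}" using assms nth_mem by blast
  then show "fps_word n (length w) (word_fps w) ! i = w ! i"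
    using i by (simp add: fps_word_def word_fps_def)
qed simp

lemma fps_word_in_lists: "n > 0 \<Longrightarrow> fps_word n L F \<in> lists {0..<int n}"
  by (auto simp: fps_word_def)

lemma fps_word_Suc:
  "fps_word n (Suc L) (fps_const a + fps_X * G) = (a mod int n) # fps_word n L G"
  by (rule nth_equalityI) (auto simp: fps_word_def nth_Cons simp del: upt_Suc split: nat.split)

lemma word_fps_Cons: "word_fps (x # w) = fps_const x + fps_X * word_fps w"
proof (rule fps_ext)
  fix i show "word_fps (x # w) $ i = (fps_const x + fps_X * word_fps w) $ i"
    by (cases i) (simp_all add: word_fps_def)
qed

text \<open>For F = x + t G one has (1 + t) F + y = (y + x) + t ((1 + t) G + x). The constant term
  is the output letter and the bracket is the action of the next state x on the remaining
  word.\<close>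

lemma run_automaton_1_plus_t:
  "run (automaton_1_plus_t n) y w =
     fps_word n (length w) ((1 + fps_X) * word_fps w + fps_const y)"
proof (induction w arbitrary: y)
  case (Cons x w)
  have "(1 + fps_X) * word_fps (x # w) + fps_const y =
      fps_const (y + x) + fps_X * ((1 + fps_X) * word_fps w + fps_const x)"
    by (simp add: word_fps_Cons algebra_simps flip: fps_const_add)
  then show ?case
    using Cons [of x] by (simp add: fps_word_Suc) (simp add: automaton_1_plus_t_def)
qed (simp add: fps_word_def)

section \<open>The action of the lamplighter group on words by affine maps\<close>

definition lamp_action :: "nat \<Rightarrow> (int \<Rightarrow> int) \<times> int \<Rightarrow> int list \<Rightarrow> int list" where
  "lamp_action n = (\<lambda>(f, k). \<lambda>w\<in>lists {0..<int n}.
     fps_word n (length w) (binomial_fps k * word_fps w + lamp_series f))"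

lemma carrier_lamp_group:
  assumes "n > 0"
  shows "carrier (lamp_group n) = {f. range f \<subseteq> {0..<int n} \<and> finite {j. f j \<noteq> 0}}"
  using assms
  by (auto simp: lamp_group_def carrier_sum_group carrier_integer_mod_group PiE_iff image_subset_iff)

lemma mult_lamp_group: "f \<otimes>\<^bsub>lamp_group n\<^esub> g = (\<lambda>i. (f i + g i) mod int n)"
  by (simp add: lamp_group_def restrict_def)

lemma carrier_lamplighter_group:
  "carrier (lamplighter_group n) = carrier (lamp_group n) \<times> UNIV"
  by (simp add: lamplighter_group_def semidirect_product_def integer_group_def)

lemma mult_lamplighter_group:
  assumes "g \<in> carrier (lamp_group n)"
  shows "(f, k) \<otimes>\<^bsub>lamplighter_group n\<^esub> (g, l) = (\<lambda>i. (f i + g (i - k)) mod int n, k + l)"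
  using assms
  by (simp add: lamplighter_group_def semidirect_product_def integer_group_def lamp_shift_def mult_lamp_group)

lemma one_lamplighter_group: "\<one>\<^bsub>lamplighter_group n\<^esub> = (\<lambda>_. 0, 0)"
  by (simp add: lamplighter_group_def semidirect_product_def integer_group_def lamp_group_def restrict_def)

text \<open>The product in \<open>lamp_group\<close> reduces each lamp modulo n, which alters the
  series only by multiples of n.\<close>

lemma lamp_series_add_mod:
  assumes "finite {j. f j \<noteq> 0}" "finite {j. g j \<noteq> 0}"
  shows "cong_below L (int n) (lamp_series (\<lambda>i. (f i + g i) mod int n)) (lamp_series f + lamp_series g)"
proof -
  let ?S = "{j. f j \<noteq> 0} \<union> {j. g j \<noteq> 0}"
  have fin: "finite ?S" using assms by simp
  have "lamp_series f + lamp_series g = (\<Sum>j\<in>?S. fps_const (f j + g j) * binomial_fps j)"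
    using fin by (subst (1 2) lamp_series_eq_sum [of ?S])
       (auto simp: sum.distrib [symmetric] distrib_right simp flip: fps_const_add)
  moreover have "lamp_series (\<lambda>i. (f i + g i) mod int n) =
      (\<Sum>j\<in>?S. fps_const ((f j + g j) mod int n) * binomial_fps j)"
    using fin by (intro lamp_series_eq_sum) auto
  ultimately show ?thesis
    by (auto simp: cong_below_def fps_sum_nth intro!: cong_sum cong_mult)
qed

text \<open>Substituting one affine map into the other multiplies the inner translation part by (1 +
  t)^k, which by \<open>lamp_series_shift\<close> moves its lamps by \<open>k\<close>.\<close>

lemma lamp_action_compose:
  assumes n: "n > 0" and f: "f \<in> carrier (lamp_group n)" and g: "g \<in> carrier (lamp_group n)"
  shows "compose (lists {0..<int n}) (lamp_action n (f, k)) (lamp_action n (g, l)) =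
    lamp_action n ((f, k) \<otimes>\<^bsub>lamplighter_group n\<^esub> (g, l))"
proof
  fix w
  let ?h = "\<lambda>i. (f i + g (i - k)) mod int n" and ?L = "length w" and ?W = "word_fps w"
  let ?G = "binomial_fps l * ?W + lamp_series g"
  have fin: "finite {j. f j \<noteq> 0}" "finite {j. g (j - k) \<noteq> 0}"
    using f lamp_shift_closed [OF g, of k] n by (simp_all add: carrier_lamp_group)
  \<comment> \<open>The word produced by the inner map determines \<open>?G\<close> only modulo n
    and t^L; that suffices for the outer map.\<close>
  have "cong_below ?L (int n) (binomial_fps k * word_fps (fps_word n ?L ?G) + lamp_series f)
      (binomial_fps k * ?G + lamp_series f)"
    by (intro cong_below_add cong_below_mult word_fps_fps_word cong_below_refl)
  moreover have "binomial_fps k * ?G + lamp_series f =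
      binomial_fps (k + l) * ?W + (lamp_series f + lamp_series (\<lambda>i. g (i - k)))"
    by (simp add: binomial_fps_add lamp_series_shift algebra_simps)
  moreover have "cong_below ?L (int n) (binomial_fps (k + l) * ?W + lamp_series ?h) \<dots>"
    by (intro cong_below_add lamp_series_add_mod fin cong_below_refl)
  ultimately have "fps_word n ?L (binomial_fps k * word_fps (fps_word n ?L ?G) + lamp_series f) =
      fps_word n ?L (binomial_fps (k + l) * ?W + lamp_series ?h)"
    by (metis fps_word_eq_iff)
  then show "compose (lists {0..<int n}) (lamp_action n (f, k)) (lamp_action n (g, l)) w =
      lamp_action n ((f, k) \<otimes>\<^bsub>lamplighter_group n\<^esub> (g, l)) w"
    using fps_word_in_lists [OF n]
    by (simp add: mult_lamplighter_group [OF g] compose_def lamp_action_def del: in_lists_conv_set)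
qed

lemma lamp_action_one:
  "lamp_action n \<one>\<^bsub>lamplighter_group n\<^esub> = (\<lambda>w\<in>lists {0..<int n}. w)"
  by (auto simp: lamp_action_def one_lamplighter_group fps_word_word_fps simp del: in_lists_conv_set)

text \<open>Compatibility with products comes first; bijectivity then follows because the inverse
  group element acts as the inverse map.\<close>

lemma lamp_action_hom:
  assumes n: "n > 0"
  shows "lamp_action n \<in> hom (lamplighter_group n) (BijGroup (lists {0..<int n}))"
proof -
  interpret L: group "lamplighter_group n" by (rule group_lamplighter_group)
  let ?X = "lists {0..<int n}"
  have comp: "lamp_action n (x \<otimes>\<^bsub>lamplighter_group n\<^esub> y) =
      compose ?X (lamp_action n x) (lamp_action n y)"
    if "x \<in> carrier (lamplighter_group n)" "y \<in> carrier (lamplighter_group n)" for x y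
    using that lamp_action_compose [OF n] by (auto simp: carrier_lamplighter_group)
  have cl: "lamp_action n x w \<in> ?X" if "w \<in> ?X" for x w
    using that fps_word_in_lists [OF n] by (auto simp: lamp_action_def split: prod.split)
  have inv: "lamp_action n x (lamp_action n y w) = w"
    if "w \<in> ?X" "x \<in> carrier (lamplighter_group n)" "y \<in> carrier (lamplighter_group n)"
      "x \<otimes>\<^bsub>lamplighter_group n\<^esub> y = \<one>\<^bsub>lamplighter_group n\<^esub>" for x y w
    using fun_cong [OF comp [OF that(2,3)], of w] that(1)
    unfolding that(4) lamp_action_one compose_def by (simp del: in_lists_conv_set)
  have Bij: "lamp_action n x \<in> Bij ?X" if x: "x \<in> carrier (lamplighter_group n)" for x
  proof -
    have "bij_betw (lamp_action n x) ?X ?X"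
      by (rule bij_betw_byWitness [where f' = "lamp_action n (inv\<^bsub>lamplighter_group n\<^esub> x)"])
         (use x in \<open>simp_all add: cl inv image_subset_iff del: in_lists_conv_set\<close>)
    then show ?thesis by (auto simp: Bij_def lamp_action_def split: prod.split)
  qed
  show ?thesis
    by (rule homI) (use Bij comp in \<open>auto simp: BijGroup_def\<close>)
qed

section \<open>Faithfulness of the action\<close>

lemma inj_lamp_action:
  assumes n: "n \<ge> 2"
  shows "inj_on (lamp_action n) (carrier (lamplighter_group n))"
proof -
  have n0: "n > 0" using n by simp
  interpret group_hom "lamplighter_group n" "BijGroup (lists {0..<int n})" "lamp_action n"
    by (intro group_hom.intro group_hom_axioms.intro group_lamplighter_group group_BijGroup
        lamp_action_hom n0)
  have "x = \<one>\<^bsub>lamplighter_group n\<^esub>"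
    if x: "x \<in> carrier (lamplighter_group n)"
      and eq: "lamp_action n x = \<one>\<^bsub>BijGroup (lists {0..<int n})\<^esub>" for x
  proof -
    obtain f k where fk: "x = (f, k)" by (cases x)
    have f: "range f \<subseteq> {0..<int n}" "finite {j. f j \<noteq> 0}"
      using x n0 by (auto simp: fk carrier_lamplighter_group carrier_lamp_group)
    have act: "cong_below (length w) (int n) (binomial_fps k * word_fps w + lamp_series f) (word_fps w)"
      if "w \<in> lists {0..<int n}" for w
    proof -
      have "lamp_action n x w = w" using eq that by (simp add: BijGroup_def)
      then show ?thesis
        using that fps_word_word_fps [OF that]
        by (simp add: fk lamp_action_def fps_word_eq_iff [symmetric] del: in_lists_conv_set)
    qed
    have series: "int n dvd lamp_series f $ i" for i
    proof -
      \<comment> \<open>The zero word isolates the translation part; length \<open>Suc i\<close>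
        keeps coefficient \<open>i\<close> below the truncation.\<close>
      let ?w = "replicate (Suc i) (0::int)"
      have "word_fps ?w = 0"
        by (rule fps_ext) (simp add: word_fps_def del: replicate_Suc)
      moreover have "?w \<in> lists {0..<int n}" using n0 by (auto simp: in_lists_conv_set)
      ultimately show ?thesis using act [of ?w] by (simp add: cong_below_def cong_0_iff)
    qed
    have f0: "f = (\<lambda>_. 0)"
    proof
      fix j
      have "int n dvd f j" using lamp_series_independent f(2) series by blast
      moreover have "0 \<le> f j" "f j < int n" using f(1) by (auto simp: image_subset_iff)
      ultimately show "f j = 0" using zdvd_not_zless by force
    qed
    have "k = 0"
    proof (rule ccontr)
      assume "k \<noteq> 0"
      let ?\<delta> = "\<lambda>(j::int) i. if i = j then 1 else 0 :: int"
      \<comment> \<open>Since f = 0, testing on the series 1 gives (1 + t)^k = 1 modulo n.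
        \<open>?d\<close> is this relation as an integer configuration; for \<open>k\<close> nonzero
        its value at \<open>k\<close> is 1, so independence would force n to divide 1.\<close>
      let ?d = "\<lambda>i. ?\<delta> k i - ?\<delta> 0 i"
      have series_d: "lamp_series ?d = binomial_fps k - 1"
        by (subst lamp_series_diff) (simp_all add: lamp_series_single)
      have "int n dvd lamp_series ?d $ i" for i
      proof -
        let ?w = "1 # replicate i (0::int)"
        have "word_fps ?w = 1"
          by (rule fps_ext) (auto simp: word_fps_def nth_Cons split: nat.split)
        moreover have "?w \<in> lists {0..<int n}" using n by (auto simp: in_lists_conv_set)
        ultimately have "[binomial_fps k $ i = (1 :: int fps) $ i] (mod int n)"
          using act [of ?w] by (simp add: cong_below_def f0)
        then show ?thesis unfolding series_d by (simp add: cong_iff_dvd_diff)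
      qed
      moreover have "finite {j. ?d j \<noteq> 0}" by (rule finite_subset [of _ "{0, k}"]) auto
      ultimately have "int n dvd ?d k" by (rule lamp_series_independent [rotated])
      then show False using \<open>k \<noteq> 0\<close> n by simp
    qed
    then show ?thesis by (simp add: fk f0 one_lamplighter_group)
  qed
  then show ?thesis using inj_on_one_iff by blast
qed

section \<open>Generators of the lamplighter group\<close>

definition lamp :: "int \<Rightarrow> int \<Rightarrow> int \<Rightarrow> int" where
  "lamp j a = (\<lambda>i. if i = j then a else 0)"

lemma lamp_in_carrier:
  assumes "a \<in> {0..<int n}"
  shows "lamp j a \<in> carrier (lamp_group n)"
proof -
  have "n > 0" using assms by auto
  moreover have "finite {i. lamp j a i \<noteq> 0}" by (rule finite_subset [of _ "{j}"]) (auto simp: lamp_def)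
  ultimately show ?thesis using assms by (auto simp: carrier_lamp_group lamp_def)
qed

lemma lamp_zero [simp]: "lamp j 0 = (\<lambda>_. 0)"
  by (auto simp: lamp_def)

text \<open>The affine map of this pair is F |-> (1 + t) F + y, the map found for state
  \<open>y\<close> in \<open>run_automaton_1_plus_t\<close>.\<close>

lemma lamp_action_generator:
  assumes "n > 0" "y \<in> {0..<int n}"
  shows "lamp_action n (lamp 0 y, 1) = state_map (automaton_1_plus_t n) y"
proof -
  have "alphabet (automaton_1_plus_t n) = {0..<int n}"
    using assms by (simp add: automaton_1_plus_t_def carrier_integer_mod_group)
  then show ?thesis
    by (simp add: lamp_action_def state_map_def run_automaton_1_plus_t lamp_def lamp_series_single
        binomial_fps_1 restrict_def fun_eq_iff)
qed

text \<open>The generator with y = 0 is the pure shift by 1. Together with the others it yields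
  every single lamp at every position, then every finite configuration, and a final shift gives an
  arbitrary element.\<close>

lemma generate_lamplighter_group:
  assumes n: "n > 0"
  shows "generate (lamplighter_group n) ((\<lambda>y. (lamp 0 y, 1)) ` {0..<int n}) =
    carrier (lamplighter_group n)" (is "?H = _")
proof
  let ?L = "lamplighter_group n"
  interpret L: group ?L by (rule group_lamplighter_group)
  have sub: "(\<lambda>y. (lamp 0 y, 1)) ` {0..<int n} \<subseteq> carrier ?L"
    using lamp_in_carrier by (auto simp: carrier_lamplighter_group)
  then show "?H \<subseteq> carrier ?L" by (rule L.generate_incl)
  have z: "(\<lambda>_. 0) \<in> carrier (lamp_group n)"
    using lamp_in_carrier [of 0 n 0] n by simp
  interpret H: subgroup ?H ?L by (rule L.generate_is_subgroup [OF sub])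
  have gen: "(lamp 0 y, 1) \<in> ?H" if "y \<in> {0..<int n}" for y
    using that by (intro generate.incl) auto
  have shift1: "(\<lambda>_. 0, 1) \<in> ?H" using gen [of 0] n by simp
  have inv_shift: "inv\<^bsub>?L\<^esub> (\<lambda>_. 0, k) = (\<lambda>_. 0, - k)" for k
    by (rule L.inv_equality)
       (auto simp: mult_lamplighter_group z one_lamplighter_group carrier_lamplighter_group)
  have shift: "(\<lambda>_. 0, k) \<in> ?H" for k
  proof (induction k rule: int_induct [where k = 0])
    case base
    then show ?case using H.one_closed by (simp add: one_lamplighter_group)
  next
    case (step1 k)
    then show ?case using H.m_closed [OF step1(2) shift1] by (simp add: mult_lamplighter_group z)
  next
    case (step2 k)
    have "(\<lambda>_. 0, - 1) \<in> ?H" using H.m_inv_closed [OF shift1] by (simp add: inv_shift)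
    from H.m_closed [OF step2(2) this] show ?case by (simp add: mult_lamplighter_group z)
  qed
  have lamps: "(lamp j y, 0) \<in> ?H" if y: "y \<in> {0..<int n}" for j y
  proof -
    \<comment> \<open>The shift - 1 - j cancels the 1 of the generator and leaves - j. Multiplying
      on the left by the shift j then carries the lamp from 0 to j and brings the second component
      back to 0.\<close>
    have "(lamp 0 y, 1 - 1 - j) \<in> ?H"
      using H.m_closed [OF gen [OF y] shift [of "- 1 - j"]] y
      by (simp add: mult_lamplighter_group z) (simp add: lamp_def if_distrib [of "\<lambda>x. x mod int n"] cong: if_cong)
    then have "(\<lambda>_. 0, j) \<otimes>\<^bsub>?L\<^esub> (lamp 0 y, - j) \<in> ?H"
      using H.m_closed [OF shift [of j]] by simp
    moreover have "(\<lambda>_. 0, j) \<otimes>\<^bsub>?L\<^esub> (lamp 0 y, - j) = (lamp j y, 0)"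
      using y by (simp add: mult_lamplighter_group lamp_in_carrier) (auto simp: lamp_def)
    ultimately show ?thesis by simp
  qed
  \<comment> \<open>The induction runs over a finite set containing the support, and its step
    switches off one lamp, which may already be off.\<close>
  have conf: "(f, 0) \<in> ?H"
    if "finite S" "{j. f j \<noteq> 0} \<subseteq> S" "range f \<subseteq> {0..<int n}" for S f
    using that
  proof (induction S arbitrary: f rule: finite_induct)
    case empty
    then have "f = (\<lambda>_. 0)" by auto
    then show ?case using shift [of 0] by simp
  next
    case (insert j S)
    have r: "f i \<in> {0..<int n}" for i using insert.prems(2) by blast
    let ?g = "f(j := 0)"
    have rg: "range ?g \<subseteq> {0..<int n}" using r n by (auto simp: image_subset_iff)
    have "(?g, 0) \<in> ?H"
      by (rule insert.IH) (use insert.prems(1) rg in auto)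
    then have "(?g, 0) \<otimes>\<^bsub>?L\<^esub> (lamp j (f j), 0) \<in> ?H"
      using lamps [OF r] H.m_closed by simp
    moreover have "(?g, 0) \<otimes>\<^bsub>?L\<^esub> (lamp j (f j), 0) = (f, 0)"
      using r by (simp add: mult_lamplighter_group lamp_in_carrier del: fun_upd_apply) (auto simp: lamp_def)
    ultimately show ?case by simp
  qed
  show "carrier ?L \<subseteq> ?H"
  proof
    fix x assume "x \<in> carrier ?L"
    then obtain f k where x: "x = (f, k)" and f: "f \<in> carrier (lamp_group n)"
      by (auto simp: carrier_lamplighter_group)
    have f': "finite {j. f j \<noteq> 0}" "range f \<subseteq> {0..<int n}"
      using f n by (auto simp: carrier_lamp_group)
    have "(f, 0) \<otimes>\<^bsub>?L\<^esub> (\<lambda>_. 0, k) \<in> ?H"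
      using H.m_closed [OF conf [OF f'(1) subset_refl f'(2)] shift] .
    moreover have "f i mod int n = f i" for i
      using f'(2) by (auto simp: image_subset_iff)
    ultimately show "x \<in> ?H" by (simp add: x mult_lamplighter_group z)
  qed
qed

section \<open>The isomorphism\<close>

theorem proposition1:
  fixes n :: nat
  assumes "n \<ge> 2"
  shows "automaton_group (automaton_1_plus_t n) \<cong> lamplighter_group n"
proof -
  let ?A = "automaton_1_plus_t n" and ?X = "{0..<int n}"
  let ?B = "BijGroup (lists ?X)" and ?L = "lamplighter_group n"
  have n: "n > 0" using assms by simp
  have A: "states ?A = ?X" "alphabet ?A = ?X"
    using n by (simp_all add: automaton_1_plus_t_def carrier_integer_mod_group)
  let ?K = "(\<lambda>y. (lamp 0 y, 1)) ` ?X"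
  interpret group_hom ?L ?B "lamp_action n"
    by (intro group_hom.intro group_hom_axioms.intro group_lamplighter_group group_BijGroup
        lamp_action_hom n)
  have img: "state_map ?A ` ?X = lamp_action n ` ?K"
    using n by (auto simp: image_image lamp_action_generator)
  have S: "state_map ?A ` ?X \<subseteq> carrier (tree_aut_group ?X)"
    using state_map_in_tree_aut_group [OF invertible_automaton_1_plus_t [OF n]] A by auto
  then have S': "state_map ?A ` ?X \<subseteq> tree_automorphisms ?X" by (simp add: tree_aut_group_def)
  have "carrier (automaton_group ?A) = generate (tree_aut_group ?X) (state_map ?A ` ?X)"
    using S by (simp add: automaton_group_def A carrier_subgroup_generated Int_absorb1)
  \<comment> \<open>Generation is moved from the tree automorphisms to all bijections of words, the
    group in which \<open>lamp_action\<close> is known to be a homomorphism.\<close>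
  also have "\<dots> = generate ?B (state_map ?A ` ?X)"
    unfolding tree_aut_group_def by (rule H.generate_consistent [OF S' subgroup_tree_automorphisms])
  also have "\<dots> = lamp_action n ` generate ?L ?K"
    unfolding img using lamp_in_carrier
    by (intro generate_img) (auto simp: carrier_lamplighter_group)
  also have "\<dots> = lamp_action n ` carrier ?L"
    by (simp only: generate_lamplighter_group [OF n])
  finally have carrier: "carrier (automaton_group ?A) = lamp_action n ` carrier ?L" .
  \<comment> \<open>Both groups multiply by composition, so the homomorphism into \<open>?B\<close>
    is also one onto the automaton group.\<close>
  have "monoid.mult (automaton_group ?A) = monoid.mult ?B"
    by (simp add: automaton_group_def subgroup_generated_def tree_aut_group_def A)
  then have "lamp_action n \<in> iso ?L (automaton_group ?A)"
    using inj_lamp_action [OF assms] carrier by (auto simp: iso_def bij_betw_def hom_def)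
  then show ?thesis
    using G.iso_sym is_isoI by blast
qed

end
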